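(* Let $k\ge 3$ and let $G$ be a $k$-graph in which every vertex lies in at least one edge, with adjacency tensor $\mathcal A$. Then zero is a strict H$^+$-eigenvalue of $\mathcal A$. Suppose that $G$ has $s$ components $G_r=(V_r,E_r)$, $r=1,\dots,s$. Let $\lambda_1=\rho(\mathcal A)$. If $\lambda_1=\rho(\mathcal A(G_r))$ for all $r=1,\dots,s$, then $\lambda_1$ is the unique H$^{++}$-eigenvalue of $\mathcal A$. Otherwise, $\mathcal A$ has no H$^{++}$-eigenvalue, and for each $r=1,\dots,s$, $\rho(\mathcal A(G_r))$ is a strict H$^+$-eigenvalue of $\mathcal A$.
   Context: A $k$-graph $G=(V,E)$ consists of a vertex set $V=\{1,\dots,n\}$ and a set $E$ of distinct $k$-element subsets of $V$ (edges). Standing assumption: every vertex lies in at least one edge. Two vertices are adjacent if they lie in a common edge; two vertices are connected if they are joined by a finite chain of successively adjacent vertices; $G$ is connected if any two of its vertices are connected. The components of $G$ are the $k$-graphs $G_r=(V_r,E_r)$ where $V_1,\dots,V_s$ are the equivalence classes of the relation of being connected and $E_r$ is the set of edges contained in $V_r$. The adjacency tensor $\mathcal A=\mathcal A(G)=(a_{i_1\cdots i_k})$ of $G$ is the $k$th order $n$-dimensional symmetric tensor with $a_{i_1\cdots i_k}=\frac1{(k-1)!}$ if $\{i_1,\dots,i_k\}\in E$ (in particular the indices are then distinct), and $0$ otherwise; $\mathcal A(G_r)$ is the adjacency tensor of $G_r$, a tensor of dimension $|V_r|$. For a real $k$th order $n$-dimensional tensor $\mathcal T=(t_{i_1\cdots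 i_k})$ and a vector $x\in\mathbb C^n$, $\mathcal Tx^{k-1}$ is the vector with $i$th component $\sum_{i_2,\dots,i_k=1}^n t_{ii_2\cdots i_k}x_{i_2}\cdots x_{i_k}$, and $x^{[k-1]}$ is the vector with components $x_i^{k-1}$. A number $\lambda\in\mathbb C$ is an eigenvalue of $\mathcal T$ with eigenvector $x$ if $x\in\mathbb C^n$, $x\neq 0$ and $\mathcal Tx^{k-1}=\lambda x^{[k-1]}$. The spectral radius $\rho(\mathcal T)$ is the largest modulus of the eigenvalues of $\mathcal T$. If $x$ is real, then $\lambda$ is real and is called an H-eigenvalue with H-eigenvector $x$. An H-eigenvalue is an H$^+$-eigenvalue if it has an H-eigenvector with all components nonnegative, an H$^{++}$-eigenvalue if it has an H-eigenvector with all components positive, and a strict H$^+$-eigenvalue if it is an H$^+$-eigenvalue but not an H$^{++}$-eigenvalue. *)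

theory Defs
  imports Complex_Main
begin

record 'a hypergraph =
  hg_verts :: "'a set"
  hg_edges :: "'a set set"

definition k_graph :: "nat \<Rightarrow> 'a hypergraph \<Rightarrow> bool" where
  "k_graph k G \<longleftrightarrow>
     finite (hg_verts G) \<and> (\<forall>e\<in>hg_edges G. e \<subseteq> hg_verts G \<and> card e = k)"

definition hg_adjacent :: "'a hypergraph \<Rightarrow> 'a \<Rightarrow> 'a \<Rightarrow> bool" where
  "hg_adjacent G u v \<longleftrightarrow> (\<exists>e\<in>hg_edges G. u \<in> e \<and> v \<in> e)"

definition hg_connected_rel :: "'a hypergraph \<Rightarrow> ('a \<times> 'a) set" where
  "hg_connected_rel G =
     {(u, v). u \<in> hg_verts G \<and> v \<in> hg_verts G \<and> (hg_adjacent G)\<^sup>*\<^sup>* u v}"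

definition hg_components :: "'a hypergraph \<Rightarrow> 'a hypergraph set" where
  "hg_components G =
     (\<lambda>W. \<lparr>hg_verts = W, hg_edges = {e \<in> hg_edges G. e \<subseteq> W}\<rparr>)
       ` (hg_verts G // hg_connected_rel G)"

text \<open>
  Each index of a tensor ranges over the finite set \<open>tensor_index\<close>, so the dimension is its
  cardinality. An entry is addressed by the list of its indices. Entries at lists of the wrong
  length or with members outside the index set are irrelevant, and so are the values of a vector
  outside the index set; in particular a vector is nonzero if it is nonzero somewhere on that set.
\<close>

record 'a tensor =
  tensor_order :: nat
  tensor_index :: "'a set"
  tensor_entry :: "'a list \<Rightarrow> real"

definition tensor_apply :: "'a tensor \<Rightarrow> ('a \<Rightarrow> complex) \<Rightarrow> 'a \<Rightarrow> complex" where
  "tensor_apply T x i =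
     (\<Sum>js | set js \<subseteq> tensor_index T \<and> length js = tensor_order T - 1.
        complex_of_real (tensor_entry T (i # js)) * prod_list (map x js))"

definition tensor_eigenpair :: "'a tensor \<Rightarrow> complex \<Rightarrow> ('a \<Rightarrow> complex) \<Rightarrow> bool" where
  "tensor_eigenpair T \<mu> x \<longleftrightarrow>
     (\<exists>i\<in>tensor_index T. x i \<noteq> 0) \<and>
     (\<forall>i\<in>tensor_index T. tensor_apply T x i = \<mu> * x i ^ (tensor_order T - 1))"

definition tensor_eigenvalue :: "'a tensor \<Rightarrow> complex \<Rightarrow> bool" where
  "tensor_eigenvalue T \<mu> \<longleftrightarrow> (\<exists>x. tensor_eigenpair T \<mu> x)"

definition tensor_spectral_radius :: "'a tensor \<Rightarrow> real" where
  "tensor_spectral_radius T = (GREATEST r. \<exists>\<mu>. tensor_eigenvalue T \<mu> \<and> r = cmod \<mu>)"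

text \<open>
  The eigenvalue is kept complex here; that it is real is a consequence of the eigenvector
  being real.
\<close>

definition H_eigenpair :: "'a tensor \<Rightarrow> complex \<Rightarrow> ('a \<Rightarrow> real) \<Rightarrow> bool" where
  "H_eigenpair T \<mu> x \<longleftrightarrow> tensor_eigenpair T \<mu> (\<lambda>i. complex_of_real (x i))"

definition H_plus_eigenvalue :: "'a tensor \<Rightarrow> complex \<Rightarrow> bool" where
  "H_plus_eigenvalue T \<mu> \<longleftrightarrow> (\<exists>x. H_eigenpair T \<mu> x \<and> (\<forall>i\<in>tensor_index T. 0 \<le> x i))"

definition H_plus_plus_eigenvalue :: "'a tensor \<Rightarrow> complex \<Rightarrow> bool" where
  "H_plus_plus_eigenvalue T \<mu> \<longleftrightarrow> (\<exists>x. H_eigenpair T \<mu> x \<and> (\<forall>i\<in>tensor_index T. 0 < x i))"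

definition strict_H_plus_eigenvalue :: "'a tensor \<Rightarrow> complex \<Rightarrow> bool" where
  "strict_H_plus_eigenvalue T \<mu> \<longleftrightarrow> H_plus_eigenvalue T \<mu> \<and> \<not> H_plus_plus_eigenvalue T \<mu>"

text \<open>
  In a \<open>k\<close>-graph an index list of length \<open>k\<close> whose members form an edge is automatically distinct.
\<close>

definition adjacency_tensor :: "nat \<Rightarrow> 'a hypergraph \<Rightarrow> 'a tensor" where
  "adjacency_tensor k G =
     \<lparr>tensor_order = k,
      tensor_index = hg_verts G,
      tensor_entry =
        (\<lambda>js. if length js = k \<and> set js \<in> hg_edges G then 1 / fact (k - 1) else 0)\<rparr>"

end

(*
  (A x^(k-1))_i is the sum over the edges e containing i of the product of x over e - {i}: each
  such edge arises from (k-1)! index lists. On a component, maximise the sum of the edge products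
  over the nonnegative vectors with sum of k-th powers equal to 1. If a maximiser vanished
  somewhere, some edge would meet both its support and its zero set; raising the zero entries to
  eps gains at least a multiple of eps^(k-1) and costs only O(eps^k). So it is positive, and
  stationarity in each coordinate is the eigenvalue equation. Comparing an arbitrary eigenvector z
  with a positive eigenvector x at an index maximising |z_i| / x_i shows that the eigenvalue of x
  is the spectral radius. Positive eigenvectors of the components then glue together exactly when
  the spectral radii agree.
*)
theory Submission
  imports Defs "HOL-Analysis.Function_Topology" "HOL-Combinatorics.Multiset_Permutations"
begin

subsection \<open>The adjacency tensor as a sum over edges\<close>

text \<open>Polymorphic because eigenvectors are constructed over the reals but compared with
  complex ones. Formally this is the partial derivative in coordinate \<open>i\<close> of the edge
  polynomial, the sum of \<open>prod x e\<close> over the edges.\<close>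

definition edge_sum :: "'a set set \<Rightarrow> ('a \<Rightarrow> 'b::comm_semiring_1) \<Rightarrow> 'a \<Rightarrow> 'b" where
  "edge_sum E x i = (\<Sum>e\<in>{e\<in>E. i \<in> e}. prod x (e - {i}))"

lemma edge_sum_of_real:
  "edge_sum E (\<lambda>i. complex_of_real (x i)) i = complex_of_real (edge_sum E x i)"
  by (simp add: edge_sum_def)

lemma finite_edges_of_subset: "finite V \<Longrightarrow> (\<And>e. e \<in> E \<Longrightarrow> e \<subseteq> V) \<Longrightarrow> finite E"
  by (rule finite_subset[of _ "Pow V"]) auto

lemma edge_sum_positive:
  fixes x :: "'a \<Rightarrow> real"
  assumes "finite E" "e \<in> E" "i \<in> e" "\<And>e j. e \<in> E \<Longrightarrow> j \<in> e \<Longrightarrow> 0 < x j"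
  shows "0 < edge_sum E x i"
  unfolding edge_sum_def
  by (rule sum_pos) (use assms in \<open>auto intro!: prod_pos\<close>)

lemma tensor_apply_adjacency:
  assumes G: "k_graph k G" and k: "k > 0" and i: "i \<in> hg_verts G"
  shows "tensor_apply (adjacency_tensor k G) x i = edge_sum (hg_edges G) x i"
proof -
  let ?V = "hg_verts G" and ?E = "hg_edges G"
  let ?L = "{js. set js \<subseteq> ?V \<and> length js = k - 1}"
  let ?I = "{e\<in>?E. i \<in> e}"
  let ?f = "\<lambda>js. complex_of_real (if set (i # js) \<in> ?E then 1 / fact (k - 1) else 0)
    * prod_list (map x js)"
  have V: "finite ?V" and E: "\<And>e. e \<in> ?E \<Longrightarrow> e \<subseteq> ?V" "\<And>e. e \<in> ?E \<Longrightarrow> card e = k"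
    using G by (auto simp: k_graph_def)
  have fE: "finite ?E"
    using V E(1) by (rule finite_edges_of_subset)
  have fin: "finite e" if "e \<in> ?E" for e
    using E(1)[OF that] V finite_subset by auto
  have fL: "finite ?L"
    using V by (rule finite_lists_length_eq)
  have card_Diff: "card (e - {i}) = k - 1" if "e \<in> ?I" for e
    using that E by simp
  have fiber: "{js \<in> ?L. set (i # js) = e} = permutations_of_set (e - {i})" (is "?A = ?B")
    if e: "e \<in> ?I" for e
  proof (intro equalityI subsetI)
    fix js assume js: "js \<in> ?A"
    \<comment> \<open>An edge has \<open>k\<close> elements and \<open>i # js\<close> has
      \<open>k\<close> entries, so no index repeats.\<close>
    then have "card (set (i # js)) = length (i # js)"
      using e E(2) k by auto
    then have "distinct (i # js)"
      by (rule card_distinct)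
    with js show "js \<in> ?B"
      by (auto simp: permutations_of_set_def)
  next
    fix js assume js: "js \<in> ?B"
    then have "length js = k - 1"
      using card_Diff[OF e] distinct_card[of js] by (auto simp: permutations_of_set_def)
    with js show "js \<in> ?A"
      using e E(1)[of e] by (auto simp: permutations_of_set_def)
  qed
  have "tensor_apply (adjacency_tensor k G) x i = sum ?f ?L"
    unfolding tensor_apply_def adjacency_tensor_def using k by (intro sum.cong) auto
  also have "\<dots> = sum ?f {js \<in> ?L. set (i # js) \<in> ?I}"
    by (rule sum.mono_neutral_right) (use fL in auto)
  also have "\<dots> = (\<Sum>e\<in>?I. sum ?f {js \<in> {js \<in> ?L. set (i # js) \<in> ?I}. set (i # js) = e})"
    by (rule sum.group[symmetric]) (use fL fE in \<open>auto intro: finite_subset[OF _ fL]\<close>)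
  also have "\<dots> = (\<Sum>e\<in>?I. prod x (e - {i}))"
  proof (rule sum.cong[OF refl])
    fix e assume e: "e \<in> ?I"
    then have "{js \<in> {js \<in> ?L. set (i # js) \<in> ?I}. set (i # js) = e} = permutations_of_set (e - {i})"
      using fiber[OF e] by auto
    moreover have "?f js = 1 / fact (k - 1) * prod x (e - {i})"
      if "js \<in> permutations_of_set (e - {i})" for js
    proof -
      have "set js = e - {i}" "distinct js"
        using that by (auto simp: permutations_of_set_def)
      moreover from this have "set (i # js) \<in> ?E"
        using e by (auto simp: insert_absorb)
      ultimately show ?thesis
        by (simp add: prod.distinct_set_conv_list[symmetric])
    qed
    \<comment> \<open>The (k-1)! orderings of \<open>e - {i}\<close> cancel the entry
      1/(k-1)!.\<close>
    ultimately show "sum ?f {js \<in> {js \<in> ?L. set (i # js) \<in> ?I}. set (i # js) = e}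
        = prod x (e - {i})"
      using card_Diff[OF e] fin[of e] e by simp
  qed
  finally show ?thesis
    by (simp add: edge_sum_def)
qed

lemma tensor_eigenpair_adjacency:
  assumes "k_graph k G" "k > 0"
  shows "tensor_eigenpair (adjacency_tensor k G) \<mu> x \<longleftrightarrow> (\<exists>i\<in>hg_verts G. x i \<noteq> 0) \<and>
    (\<forall>i\<in>hg_verts G. edge_sum (hg_edges G) x i = \<mu> * x i ^ (k - 1))"
  using tensor_apply_adjacency[OF assms]
  by (simp add: tensor_eigenpair_def) (simp add: adjacency_tensor_def)

lemma tensor_index_adjacency [simp]: "tensor_index (adjacency_tensor k G) = hg_verts G"
  by (simp add: adjacency_tensor_def)

subsection \<open>Positive eigenvectors and the spectral radius\<close>

text \<open>Let \<open>t\<close> be the largest ratio \<open>cmod (z i) / x i\<close>, attained at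
  \<open>i\<close>. The modulus of \<open>z\<close> equals \<open>t * x\<close> there and is at most
  \<open>t * x\<close> elsewhere, so the triangle inequality bounds the equation for
  \<open>z\<close> at \<open>i\<close> by \<open>t ^ (k - 1)\<close> times that for
  \<open>x\<close>.\<close>

lemma cmod_eigenvalue_le:
  fixes x :: "'a \<Rightarrow> real" and z :: "'a \<Rightarrow> complex"
  assumes V: "finite V" and E: "\<And>e. e \<in> E \<Longrightarrow> e \<subseteq> V \<and> card e = k"
    and pos: "\<And>i. i \<in> V \<Longrightarrow> 0 < x i"
    and x: "\<And>i. i \<in> V \<Longrightarrow> edge_sum E x i = c * x i ^ (k - 1)"
    and z0: "\<exists>i\<in>V. z i \<noteq> 0"
    and z: "\<And>i. i \<in> V \<Longrightarrow> edge_sum E z i = \<mu> * z i ^ (k - 1)"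
  shows "cmod \<mu> \<le> c"
proof -
  define t where "t = Max ((\<lambda>i. cmod (z i) / x i) ` V)"
  have "t \<in> (\<lambda>i. cmod (z i) / x i) ` V"
    unfolding t_def using V z0 by (intro Max_in) auto
  then obtain i where i: "i \<in> V" "t = cmod (z i) / x i"
    by auto
  have le: "cmod (z j) \<le> t * x j" if "j \<in> V" for j
  proof -
    have "cmod (z j) / x j \<le> t"
      unfolding t_def using V that by (intro Max_ge) auto
    then show ?thesis
      using pos[OF that] by (simp add: field_simps)
  qed
  \<comment> \<open>A nonzero entry of \<open>z\<close> makes \<open>t\<close> positive, so that
    \<open>(t * x i) ^ (k - 1)\<close> can be cancelled at the end.\<close>
  obtain j where "j \<in> V" "z j \<noteq> 0"
    using z0 by auto
  then have "0 < t * x j"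
    using le[of j] by (smt (verit) zero_less_norm_iff)
  then have t: "0 < t"
    using pos[OF \<open>j \<in> V\<close>] by (simp add: zero_less_mult_iff)
  have zi: "cmod (z i) = t * x i"
    using i pos[of i] by simp
  have "cmod \<mu> * (t * x i) ^ (k - 1) = cmod (edge_sum E z i)"
    using z[OF i(1)] zi by (simp add: norm_mult norm_power)
  also have "\<dots> \<le> (\<Sum>e\<in>{e\<in>E. i \<in> e}. t ^ (k - 1) * prod x (e - {i}))"
    unfolding edge_sum_def
  proof (rule sum_norm_le)
    fix e assume e: "e \<in> {e\<in>E. i \<in> e}"
    then have card: "card (e - {i}) = k - 1"
      using E by auto
    have "cmod (prod z (e - {i})) = (\<Prod>j\<in>e - {i}. cmod (z j))"
      by (simp add: prod_norm)
    also have "\<dots> \<le> (\<Prod>j\<in>e - {i}. t * x j)"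
      using e E by (intro prod_mono conjI le norm_ge_zero) blast
    also have "\<dots> = t ^ (k - 1) * prod x (e - {i})"
      using card by (simp add: prod.distrib)
    finally show "cmod (prod z (e - {i})) \<le> t ^ (k - 1) * prod x (e - {i})" .
  qed
  also have "\<dots> = t ^ (k - 1) * edge_sum E x i"
    by (simp add: edge_sum_def sum_distrib_left)
  also have "\<dots> = c * (t * x i) ^ (k - 1)"
    using x[OF i(1)] by (simp add: power_mult_distrib)
  finally show ?thesis
    using t pos[OF i(1)] by simp
qed

lemma spectral_radius_adjacency_eq:
  fixes x :: "'a \<Rightarrow> real"
  assumes G: "k_graph k G" "k > 0" and ne: "hg_verts G \<noteq> {}"
    and pos: "\<And>i. i \<in> hg_verts G \<Longrightarrow> 0 < x i"
    and x: "\<And>i. i \<in> hg_verts G \<Longrightarrow> edge_sum (hg_edges G) x i = c * x i ^ (k - 1)"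
  shows "tensor_spectral_radius (adjacency_tensor k G) = c"
proof -
  have V: "finite (hg_verts G)" and E: "\<And>e. e \<in> hg_edges G \<Longrightarrow> e \<subseteq> hg_verts G \<and> card e = k"
    using G by (auto simp: k_graph_def)
  obtain i where i: "i \<in> hg_verts G"
    using ne by auto
  have pair: "tensor_eigenpair (adjacency_tensor k G) (complex_of_real c)
      (\<lambda>i. complex_of_real (x i))"
    unfolding tensor_eigenpair_adjacency[OF G] edge_sum_of_real
    using pos[OF i] i x by (intro conjI bexI[of _ i] ballI) simp_all
  have le: "cmod \<mu> \<le> c" if \<mu>: "tensor_eigenvalue (adjacency_tensor k G) \<mu>" for \<mu>
  proof -
    obtain z where "\<exists>i\<in>hg_verts G. z i \<noteq> 0"
      "\<forall>i\<in>hg_verts G. edge_sum (hg_edges G) z i = \<mu> * z i ^ (k - 1)"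
      using \<mu> unfolding tensor_eigenvalue_def tensor_eigenpair_adjacency[OF G] by blast
    then show ?thesis
      by (intro cmod_eigenvalue_le[OF V E pos x, of z]) simp_all
  qed
  have ev: "tensor_eigenvalue (adjacency_tensor k G) (complex_of_real c)"
    using pair tensor_eigenvalue_def by blast
  \<comment> \<open>The bound applied to the eigenvalue \<open>c\<close> itself gives |c| \<le> c,
    so \<open>c\<close> is nonnegative and is one of the moduli; the maximum is therefore
    attained.\<close>
  have "c = cmod (complex_of_real c)"
    using le[OF ev] by simp
  with ev le show ?thesis
    unfolding tensor_spectral_radius_def
    by (intro Greatest_equality) blast+
qed

text \<open>Positivity lets the equation be solved for \<mu> at any single vertex, as a quotient of
  reals. Later arguments about positive eigenvectors can then stay over the reals.\<close>

lemma H_plus_plus_adjacency_iff: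
  assumes G: "k_graph k G" "k > 0" and ne: "hg_verts G \<noteq> {}"
  shows "H_plus_plus_eigenvalue (adjacency_tensor k G) \<mu> \<longleftrightarrow>
    (\<exists>c x. \<mu> = complex_of_real c \<and> (\<forall>i\<in>hg_verts G. 0 < x i) \<and>
      (\<forall>i\<in>hg_verts G. edge_sum (hg_edges G) x i = c * x i ^ (k - 1)))" (is "?L \<longleftrightarrow> ?R")
proof
  assume ?L
  then obtain x where pos: "\<forall>i\<in>hg_verts G. 0 < x i"
    and x: "\<forall>i\<in>hg_verts G. complex_of_real (edge_sum (hg_edges G) x i)
      = \<mu> * complex_of_real (x i) ^ (k - 1)"
    by (auto simp: H_plus_plus_eigenvalue_def H_eigenpair_def tensor_eigenpair_adjacency[OF G]
        edge_sum_of_real)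
  obtain i where i: "i \<in> hg_verts G"
    using ne by auto
  define c where "c = edge_sum (hg_edges G) x i / x i ^ (k - 1)"
  have c: "\<mu> = complex_of_real c"
    using x i pos by (force simp: c_def field_simps)
  have "edge_sum (hg_edges G) x j = c * x j ^ (k - 1)" if "j \<in> hg_verts G" for j
  proof -
    have "complex_of_real (edge_sum (hg_edges G) x j) = complex_of_real (c * x j ^ (k - 1))"
      using x that c by simp
    then show ?thesis
      by (simp only: of_real_eq_iff)
  qed
  with c pos show ?R
    by blast
next
  assume ?R
  then obtain c x where "\<mu> = complex_of_real c" "\<forall>i\<in>hg_verts G. 0 < x i"
    "\<forall>i\<in>hg_verts G. edge_sum (hg_edges G) x i = c * x i ^ (k - 1)"
    by blast
  then show ?L
    using ne unfolding H_plus_plus_eigenvalue_def H_eigenpair_def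
      tensor_eigenpair_adjacency[OF G] edge_sum_of_real
    by (intro exI[of _ x]) force
qed

text \<open>A positive eigenvector certifies its eigenvalue as the spectral radius; applied both to
  the whole graph and to single components.\<close>

lemma H_plus_plus_adjacency_unique:
  assumes "k_graph k G" "k > 0" "hg_verts G \<noteq> {}"
    and "H_plus_plus_eigenvalue (adjacency_tensor k G) \<mu>"
  shows "\<mu> = complex_of_real (tensor_spectral_radius (adjacency_tensor k G))"
proof -
  obtain c x where "\<mu> = complex_of_real c" "\<forall>i\<in>hg_verts G. 0 < x i"
    "\<forall>i\<in>hg_verts G. edge_sum (hg_edges G) x i = c * x i ^ (k - 1)"
    using assms(4) unfolding H_plus_plus_adjacency_iff[OF assms(1-3)] by blast
  then show ?thesis
    using spectral_radius_adjacency_eq[OF assms(1-3), of x c] by simp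
qed

subsection \<open>Existence of a positive eigenvector\<close>

text \<open>Compactness yields a maximiser on the nonnegative unit sphere of the k-norm. Both sides
  of the last inequality are homogeneous of degree \<open>k\<close>, so it extends to all
  nonnegative \<open>y\<close>, and later perturbations need no normalisation.\<close>

lemma edge_products_attain_max:
  fixes k :: nat
  assumes V: "finite V" "V \<noteq> {}" and E: "\<And>e. e \<in> E \<Longrightarrow> e \<subseteq> V \<and> card e = k" and k: "k > 0"
  obtains x :: "'a \<Rightarrow> real" where "\<And>i. i \<in> V \<Longrightarrow> 0 \<le> x i" "(\<Sum>i\<in>V. x i ^ k) = 1"
    "\<And>y. (\<And>i. i \<in> V \<Longrightarrow> 0 \<le> y i) \<Longrightarrow>
      (\<Sum>e\<in>E. prod y e) \<le> (\<Sum>e\<in>E. prod x e) * (\<Sum>i\<in>V. y i ^ k)"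
proof -
  define F :: "('a \<Rightarrow> real) \<Rightarrow> real" where "F x = (\<Sum>e\<in>E. prod x e)" for x
  define N :: "('a \<Rightarrow> real) \<Rightarrow> real" where "N x = (\<Sum>i\<in>V. x i ^ k)" for x
  \<comment> \<open>Fixing the coordinates outside \<open>V\<close> at 0 makes this a product of
    compact sets. Nonnegative vectors with \<open>N\<close> equal to 1 have their coordinates on
    \<open>V\<close> in [0,1].\<close>
  define B where "B = PiE UNIV (\<lambda>i. if i \<in> V then {0..1::real} else {0})"
  have "compactin (product_topology (\<lambda>i::'a. (euclidean :: real topology)) UNIV) B"
    unfolding B_def by (subst compactin_PiE) auto
  then have B: "compact B"
    by (simp add: euclidean_product_topology)
  have coord: "continuous_on S (\<lambda>x. x i :: real)" for S :: "('a \<Rightarrow> real) set" and i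
    using continuous_on_product_coordinates by (rule continuous_on_subset) simp
  have cont: "continuous_on S F" "continuous_on S N" for S
    unfolding F_def N_def by (auto intro!: continuous_intros coord)
  have "closed {x. N x = 1}"
    by (intro closed_Collect_eq cont continuous_intros)
  then have K: "compact (B \<inter> {x. N x = 1})"
    using B by blast
  obtain v where v: "v \<in> V"
    using V by auto
  \<comment> \<open>An indicator vector shows that the constraint set is nonempty.\<close>
  have "N (\<lambda>i. if i = v then 1 else 0) = (\<Sum>i\<in>V. if i = v then 1 else 0)"
    unfolding N_def using k by (intro sum.cong) auto
  then have "(\<lambda>i. if i = v then 1 else 0) \<in> B \<inter> {x. N x = 1}"
    using v V(1) by (auto simp: B_def PiE_iff)
  then obtain x where x: "x \<in> B" "N x = 1" and max: "\<And>y. y \<in> B \<Longrightarrow> N y = 1 \<Longrightarrow> F y \<le> F x"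
    using continuous_attains_sup[OF K _ cont(1)] by blast
  have "F y \<le> F x * N y" if y: "\<And>i. i \<in> V \<Longrightarrow> 0 \<le> y i" for y
  proof (cases "\<exists>i\<in>V. y i \<noteq> 0")
    case False
    \<comment> \<open>As \<open>k > 0\<close>, every edge is nonempty and so contains a zero of
      \<open>y\<close>.\<close>
    have "prod y e = 0" if "e \<in> E" for e
    proof -
      have "finite e" "e \<noteq> {}"
        using E[OF that] V k finite_subset by auto
      then show ?thesis
        using E[OF that] False by (auto simp: prod_zero_iff)
    qed
    then have "F y = 0" "N y = 0"
      using False k by (simp_all add: F_def N_def)
    then show ?thesis
      by simp
  next
    case True
    then obtain j where j: "j \<in> V" "0 < y j"
      using y by (metis less_le)
    have pos: "0 < N y"
      unfolding N_def by (rule sum_pos2[OF V(1) j(1)]) (use j y in simp_all)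
    \<comment> \<open>Scaling by \<open>c\<close> normalises \<open>y\<close>; setting
      \<open>w\<close> to 0 outside \<open>V\<close> puts it in \<open>B\<close>.\<close>
    define c where "c = 1 / root k (N y)"
    have c: "c > 0" "c ^ k * N y = 1"
      using pos k by (auto simp: c_def power_divide)
    define w where "w i = (if i \<in> V then c * y i else 0)" for i
    have Nw: "N w = 1"
      using c(2) by (simp add: N_def w_def power_mult_distrib sum_distrib_left)
    have w0: "0 \<le> w i" for i
      using c y by (simp add: w_def)
    have "w i \<le> 1" if "i \<in> V" for i
    proof -
      have "w i ^ k \<le> N w"
        unfolding N_def using V that w0 by (intro member_le_sum) auto
      then show ?thesis
        using Nw w0 k power_le_one_iff[of "w i" k] by auto
    qed
    then have "w i \<in> (if i \<in> V then {0..1} else {0})" for i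
      using w0[of i] by (cases "i \<in> V") (simp_all add: w_def)
    then have "w \<in> B"
      by (simp add: B_def PiE_iff)
    then have "F w \<le> F x"
      using max Nw by blast
    moreover have "F w = c ^ k * F y"
      unfolding F_def sum_distrib_left
    proof (rule sum.cong[OF refl])
      fix e assume e: "e \<in> E"
      have "prod w e = (\<Prod>i\<in>e. c * y i)"
        using E[OF e] by (intro prod.cong) (auto simp: w_def)
      then show "prod w e = c ^ k * prod y e"
        using E[OF e] by (simp add: prod.distrib)
    qed
    ultimately have "c ^ k * F y * N y \<le> F x * N y"
      using pos by (metis mult_right_mono less_imp_le)
    moreover have "c ^ k * F y * N y = F y * (c ^ k * N y)"
      by (simp only: mult_ac)
    ultimately show ?thesis
      unfolding c(2) by simp
  qed
  moreover have "0 \<le> x i" if "i \<in> V" for i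
    using PiE_mem[OF x(1)[unfolded B_def], of i] that by simp
  ultimately show ?thesis
    using that[of x] x(2) by (simp add: F_def N_def)
qed

text \<open>Connectedness is assumed in cut form, ready to be applied to the support of a maximiser.
  In place of Lagrange multipliers, the homogeneous inequality is differentiated in one coordinate
  at a time.\<close>

lemma exists_positive_edge_eigenvector:
  fixes k :: nat
  assumes V: "finite V" "V \<noteq> {}" and E: "\<And>e. e \<in> E \<Longrightarrow> e \<subseteq> V \<and> card e = k" and k: "k > 0"
    and connected: "\<And>S. S \<subseteq> V \<Longrightarrow> S \<noteq> {} \<Longrightarrow>
      (\<And>e. e \<in> E \<Longrightarrow> e \<inter> S \<noteq> {} \<Longrightarrow> e \<subseteq> S) \<Longrightarrow> S = V"
  obtains x :: "'a \<Rightarrow> real" and c where "\<And>i. i \<in> V \<Longrightarrow> 0 < x i"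
    "\<And>i. i \<in> V \<Longrightarrow> edge_sum E x i = c * x i ^ (k - 1)"
proof -
  obtain x :: "'a \<Rightarrow> real" where x0: "\<And>i. i \<in> V \<Longrightarrow> 0 \<le> x i"
    and x1: "(\<Sum>i\<in>V. x i ^ k) = 1"
    and max: "\<And>y. (\<And>i. i \<in> V \<Longrightarrow> 0 \<le> y i) \<Longrightarrow>
      (\<Sum>e\<in>E. prod y e) \<le> (\<Sum>e\<in>E. prod x e) * (\<Sum>i\<in>V. y i ^ k)"
    using edge_products_attain_max[OF V E k] by blast
  define c where "c = (\<Sum>e\<in>E. prod x e)"
  have fE: "finite E"
    using V(1) E by (intro finite_edges_of_subset) auto
  have fin: "finite e" if "e \<in> E" for e
    using E[OF that] V finite_subset by auto
  have c0: "0 \<le> c"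
    unfolding c_def using E x0 by (intro sum_nonneg prod_nonneg) blast
  define S where "S = {i\<in>V. x i \<noteq> 0}"
  have "S \<noteq> {}"
  proof
    assume "S = {}"
    then have "(\<Sum>i\<in>V. x i ^ k) = 0"
      using k by (intro sum.neutral) (auto simp: S_def)
    then show False
      using x1 by simp
  qed
  have "S = V"
  proof (rule ccontr)
    assume "S \<noteq> V"
    \<comment> \<open>An edge leaving the support; \<open>p\<close> is the factor of its product
      that the perturbation below keeps.\<close>
    then obtain e where e: "e \<in> E" "e \<inter> S \<noteq> {}" "\<not> e \<subseteq> S"
      using connected[of S] \<open>S \<noteq> {}\<close> by (auto simp: S_def)
    define p where "p = prod x (e \<inter> S)"
    have p: "0 < p"
      unfolding p_def using x0 by (intro prod_pos) (auto simp: S_def less_le)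
    \<comment> \<open>With the zeros of \<open>x\<close> replaced by \<epsilon>, maximality compares
      a gain of at least \<open>p * \<epsilon> ^ (k - 1)\<close> with a cost of at most
      \<open>c * card V * \<epsilon> ^ k\<close>.\<close>
    have bound: "p \<le> c * card V * \<epsilon>" if \<epsilon>: "0 < \<epsilon>" "\<epsilon> \<le> 1" for \<epsilon> :: real
    proof -
      define y where "y i = (if x i = 0 then \<epsilon> else x i)" for i
      have y: "0 \<le> y i" "x i \<le> y i" if "i \<in> V" for i
        using x0 that \<epsilon> by (auto simp: y_def)
      have mono: "prod x d \<le> prod y d" if "d \<in> E" for d
        using E[OF that] x0 y by (intro prod_mono) blast
      have "prod x e = 0"
        using e E[OF e(1)] fin[OF e(1)] by (auto simp: prod_zero_iff S_def)
      have "prod y e = prod y (e \<inter> S) * prod y (e - S)"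
        by (rule prod.Int_Diff) (rule fin[OF e(1)])
      also have "prod y (e \<inter> S) = p"
        unfolding p_def by (intro prod.cong) (auto simp: S_def y_def)
      also have "prod y (e - S) = (\<Prod>i\<in>e - S. \<epsilon>)"
        using E[OF e(1)] by (intro prod.cong) (auto simp: S_def y_def)
      finally have ye: "prod y e = p * \<epsilon> ^ card (e - S)"
        by simp
      \<comment> \<open>Since \<open>e\<close> meets the support, at most \<open>k - 1\<close> of
        its entries were raised; as \<epsilon> \<le> 1, enlarging the exponent to
        \<open>k - 1\<close> only lowers the power.\<close>
      have "card (e - S) < card e"
        using e fin[OF e(1)] by (intro psubset_card_mono) auto
      then have "card (e - S) \<le> k - 1"
        using E[OF e(1)] by simp
      then have "\<epsilon> ^ (k - 1) \<le> \<epsilon> ^ card (e - S)"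
        using \<epsilon> by (intro power_decreasing) auto
      then have "p * \<epsilon> ^ (k - 1) \<le> prod y e - prod x e"
        using ye p \<open>prod x e = 0\<close> by simp
      \<comment> \<open>No edge product decreases, so the gain on \<open>e\<close> is at most the
        total gain.\<close>
      also have "\<dots> \<le> (\<Sum>d\<in>E. prod y d - prod x d)"
        using mono e(1) fE by (intro member_le_sum) auto
      also have "\<dots> = (\<Sum>d\<in>E. prod y d) - c"
        by (simp add: sum_subtractf c_def)
      also have "\<dots> \<le> c * (\<Sum>i\<in>V. y i ^ k) - c"
        using max[of y] y by (simp add: c_def)
      also have "(\<Sum>i\<in>V. y i ^ k) \<le> (\<Sum>i\<in>V. x i ^ k + \<epsilon> ^ k)"
        using \<epsilon> k by (intro sum_mono) (auto simp: y_def)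
      then have "c * (\<Sum>i\<in>V. y i ^ k) - c \<le> c * (1 + card V * \<epsilon> ^ k) - c"
        using c0 x1 by (intro diff_right_mono mult_left_mono) (auto simp: sum.distrib)
      also have "\<dots> = c * card V * \<epsilon> * \<epsilon> ^ (k - 1)"
        using k by (simp add: algebra_simps power_eq_if)
      finally show ?thesis
        using \<epsilon> by simp
    qed
    define q where "q = c * card V"
    have q: "0 \<le> q"
      using c0 by (simp add: q_def)
    \<comment> \<open>Small enough to contradict the bound; the added 1 keeps the divisor positive
      when \<open>q\<close> is 0 and makes the comparison strict.\<close>
    define \<epsilon> where "\<epsilon> = min 1 (p / (q + 1))"
    have "0 < \<epsilon>" "\<epsilon> \<le> 1"
      using p q by (auto simp: \<epsilon>_def)
    then have "p \<le> q * \<epsilon>"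
      using bound by (simp add: q_def)
    also have "\<dots> < (q + 1) * \<epsilon>"
      using \<open>0 < \<epsilon>\<close> by simp
    also have "\<dots> \<le> (q + 1) * (p / (q + 1))"
      using q by (intro mult_left_mono) (auto simp: \<epsilon>_def)
    also have "\<dots> = p"
      using q by simp
    finally show False
      by simp
  qed
  then have pos: "0 < x i" if "i \<in> V" for i
    using x0[OF that] that by (auto simp: S_def less_le)
  \<comment> \<open>The eigenvalue is \<open>k\<close> times the maximum, the factor
    \<open>k\<close> coming from the derivative of \<open>t ^ k\<close>.\<close>
  have "edge_sum E x i = (c * k) * x i ^ (k - 1)" if i: "i \<in> V" for i
  proof -
    define b where "b = (\<Sum>e\<in>{e\<in>E. i \<notin> e}. prod x e)"
    define d where "d = (\<Sum>j\<in>V - {i}. x j ^ k)"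
    \<comment> \<open>The two sides of \<open>max\<close> subtracted, with only coordinate
      \<open>i\<close> varying. The edge part is affine in \<open>t\<close> because an edge contains
      \<open>i\<close> at most once.\<close>
    define g where "g t = t * edge_sum E x i + b - c * (t ^ k + d)" for t
    have split: "(\<Sum>e\<in>E. prod (x(i := t)) e) - c * (\<Sum>j\<in>V. (x(i := t)) j ^ k) = g t" for t
    proof -
      have "(\<Sum>e\<in>E. prod (x(i := t)) e) = (\<Sum>e\<in>{e\<in>E. i \<in> e}. prod (x(i := t)) e)
          + (\<Sum>e\<in>{e\<in>E. i \<notin> e}. prod (x(i := t)) e)"
        using fE by (subst sum.union_disjoint[symmetric]) (auto intro!: sum.cong)
      also have "(\<Sum>e\<in>{e\<in>E. i \<notin> e}. prod (x(i := t)) e) = b"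
        unfolding b_def by (intro sum.cong prod.cong) auto
      also have "(\<Sum>e\<in>{e\<in>E. i \<in> e}. prod (x(i := t)) e) = t * edge_sum E x i"
        unfolding edge_sum_def sum_distrib_left
      proof (intro sum.cong refl)
        fix e assume e: "e \<in> {e\<in>E. i \<in> e}"
        have "prod (x(i := t)) e = t * prod (x(i := t)) (e - {i})"
          using e fin by (subst prod.remove[of _ i]) auto
        also have "prod (x(i := t)) (e - {i}) = prod x (e - {i})"
          by (intro prod.cong) auto
        finally show "prod (x(i := t)) e = t * prod x (e - {i})" .
      qed
      finally have 1: "(\<Sum>e\<in>E. prod (x(i := t)) e) = t * edge_sum E x i + b" .
      have "(\<Sum>j\<in>V. (x(i := t)) j ^ k) = t ^ k + (\<Sum>j\<in>V - {i}. (x(i := t)) j ^ k)"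
        using V i by (subst sum.remove[of _ i]) auto
      also have "(\<Sum>j\<in>V - {i}. (x(i := t)) j ^ k) = d"
        unfolding d_def by (intro sum.cong) auto
      finally show ?thesis
        using 1 by (simp add: g_def)
    qed
    have "g (x i) = 0"
      using split[of "x i"] x1 by (simp add: c_def)
    moreover have "g t \<le> 0" if "0 < t" for t
    proof -
      have "0 \<le> (x(i := t)) j" if "j \<in> V" for j
        using x0[OF that] \<open>0 < t\<close> by simp
      then have "(\<Sum>e\<in>E. prod (x(i := t)) e) \<le> c * (\<Sum>j\<in>V. (x(i := t)) j ^ k)"
        unfolding c_def by (rule max)
      then show ?thesis
        using split[of t] by linarith
    qed
    \<comment> \<open>Within distance \<open>x i\<close> of \<open>x i\<close> every
      \<open>t\<close> is positive, so \<open>max\<close> applies there.\<close>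
    ultimately have local_max: "\<forall>t. \<bar>x i - t\<bar> < x i \<longrightarrow> g t \<le> g (x i)"
      by auto
    have "(g has_real_derivative edge_sum E x i - c * (k * x i ^ (k - 1))) (at (x i))"
      unfolding g_def by (auto intro!: derivative_eq_intros)
    then have "edge_sum E x i - c * (k * x i ^ (k - 1)) = 0"
      by (rule DERIV_local_max[OF _ pos[OF i] local_max])
    then show ?thesis
      by simp
  qed
  with pos show ?thesis
    using that by blast
qed

subsection \<open>Components\<close>

lemma equiv_hg_connected_rel: "equiv (hg_verts G) (hg_connected_rel G)"
proof -
  have "symp (hg_adjacent G)"
    by (auto simp: symp_def hg_adjacent_def)
  then have "symp (hg_adjacent G)\<^sup>*\<^sup>*"
    by (rule symp_rtranclp)
  then show ?thesis
    by (auto simp: equiv_def refl_on_def sym_def trans_def hg_connected_rel_def dest: sympD)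
qed

lemma component_class:
  assumes "W \<in> hg_verts G // hg_connected_rel G"
  shows "W \<noteq> {}" "W \<subseteq> hg_verts G"
  using assms equiv_hg_connected_rel[of G]
  by (auto simp: in_quotient_imp_non_empty dest: in_quotient_imp_subset)

text \<open>Vertices of one edge are adjacent to each other, so no edge crosses between
  classes.\<close>

lemma edge_subset_class:
  assumes G: "k_graph k G" and W: "W \<in> hg_verts G // hg_connected_rel G"
    and e: "e \<in> hg_edges G" "i \<in> e" "i \<in> W"
  shows "e \<subseteq> W"
proof
  fix j assume "j \<in> e"
  then have "(i, j) \<in> hg_connected_rel G"
    using e G unfolding hg_connected_rel_def k_graph_def
    by (intro CollectI case_prodI conjI r_into_rtranclp) (auto simp: hg_adjacent_def)
  then show "j \<in> W"
    using in_quotient_imp_closed[OF equiv_hg_connected_rel W e(3)] by blast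
qed

text \<open>Supplies the cut form of connectedness. Membership in \<open>S\<close> propagates along
  a chain starting in \<open>S\<close>: each linking edge lies in \<open>W\<close> and meets
  \<open>S\<close>, hence lies in \<open>S\<close>.\<close>

lemma class_connected:
  assumes G: "k_graph k G" and W: "W \<in> hg_verts G // hg_connected_rel G"
    and S: "S \<subseteq> W" "S \<noteq> {}"
    and closed: "\<And>e. e \<in> hg_edges G \<Longrightarrow> e \<subseteq> W \<Longrightarrow> e \<inter> S \<noteq> {} \<Longrightarrow> e \<subseteq> S"
  shows "S = W"
proof -
  obtain u where u: "u \<in> S"
    using S by auto
  have "v \<in> S" if "v \<in> W" for v
  proof -
    have "(u, v) \<in> hg_connected_rel G"
      using quotient_eq_iff[OF equiv_hg_connected_rel W W] u S(1) that by auto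
    then have "(hg_adjacent G)\<^sup>*\<^sup>* u v"
      by (simp add: hg_connected_rel_def)
    then show ?thesis
    proof induction
      case base
      show ?case by (rule u)
    next
      case (step v w)
      then obtain e where "e \<in> hg_edges G" "v \<in> e" "w \<in> e"
        by (auto simp: hg_adjacent_def)
      then show ?case
        using closed[of e] edge_subset_class[OF G W, of e v] step.IH S(1) by blast
    qed
  qed
  then show ?thesis
    using S(1) by blast
qed

section \<open>Restriction of the eigenvector equations to a component\<close>

lemma k_graph_induced:
  assumes "k_graph k G" "W \<subseteq> hg_verts G"
  shows "k_graph k \<lparr>hg_verts = W, hg_edges = {e \<in> hg_edges G. e \<subseteq> W}\<rparr>"
  using assms finite_subset by (auto simp: k_graph_def)

lemma edge_sum_class:
  assumes "k_graph k G" "W \<in> hg_verts G // hg_connected_rel G" "i \<in> W"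
  shows "edge_sum {e \<in> hg_edges G. e \<subseteq> W} x i = edge_sum (hg_edges G) x i"
  unfolding edge_sum_def using edge_subset_class[OF assms(1,2) _ _ assms(3)]
  by (intro sum.cong) auto

text \<open>The equation is stated with the edges of \<open>G\<close>, which agree with those of
  \<open>C\<close> at the vertices of \<open>C\<close>; this form suits extension and
  gluing.\<close>

lemma component_positive_eigenvector:
  assumes G: "k_graph k G" "k > 0" and C: "C \<in> hg_components G"
  obtains x :: "'a \<Rightarrow> real" where "\<And>i. i \<in> hg_verts C \<Longrightarrow> 0 < x i"
    "\<And>i. i \<in> hg_verts C \<Longrightarrow>
      edge_sum (hg_edges G) x i = tensor_spectral_radius (adjacency_tensor k C) * x i ^ (k - 1)"
proof -
  obtain W where W: "W \<in> hg_verts G // hg_connected_rel G"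
    and C: "C = \<lparr>hg_verts = W, hg_edges = {e \<in> hg_edges G. e \<subseteq> W}\<rparr>"
    using C by (auto simp: hg_components_def)
  note W' = component_class[OF W]
  have kC: "k_graph k C"
    unfolding C using G(1) W'(2) by (rule k_graph_induced)
  let ?E = "{e \<in> hg_edges G. e \<subseteq> W}"
  have "finite W" and E: "\<And>e. e \<in> ?E \<Longrightarrow> e \<subseteq> W \<and> card e = k"
    using kC by (auto simp: C k_graph_def)
  moreover have "S = W" if "S \<subseteq> W" "S \<noteq> {}"
    and "\<And>e. e \<in> ?E \<Longrightarrow> e \<inter> S \<noteq> {} \<Longrightarrow> e \<subseteq> S" for S
    by (rule class_connected[OF G(1) W that(1,2)]) (use that(3) in blast)
  ultimately obtain x :: "'a \<Rightarrow> real" and c where pos: "\<And>i. i \<in> W \<Longrightarrow> 0 < x i"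
    and x: "\<And>i. i \<in> W \<Longrightarrow> edge_sum ?E x i = c * x i ^ (k - 1)"
    using exists_positive_edge_eigenvector[OF _ W'(1) _ G(2), of ?E] by blast
  have "tensor_spectral_radius (adjacency_tensor k C) = c"
    by (rule spectral_radius_adjacency_eq[OF kC G(2), of x]) (use C W' pos x in auto)
  then show ?thesis
    using pos x edge_sum_class[OF G(1) W, of _ x] by (intro that[of x]) (simp_all add: C)
qed

text \<open>A positive eigenvector of \<open>G\<close> restricts to one of \<open>C\<close> with the
  same eigenvalue, so its existence forces all components to share one spectral radius.\<close>

lemma component_spectral_radius:
  assumes G: "k_graph k G" "k > 0" and C: "C \<in> hg_components G"
    and \<mu>: "H_plus_plus_eigenvalue (adjacency_tensor k G) \<mu>"
  shows "\<mu> = complex_of_real (tensor_spectral_radius (adjacency_tensor k C))"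
proof -
  obtain W where W: "W \<in> hg_verts G // hg_connected_rel G"
    and C: "C = \<lparr>hg_verts = W, hg_edges = {e \<in> hg_edges G. e \<subseteq> W}\<rparr>"
    using C by (auto simp: hg_components_def)
  note W' = component_class[OF W]
  have kC: "k_graph k C"
    unfolding C using G(1) W'(2) by (rule k_graph_induced)
  have "hg_verts G \<noteq> {}" "hg_verts C \<noteq> {}"
    using W' C by auto
  obtain c x where "\<mu> = complex_of_real c" "\<forall>i\<in>hg_verts G. 0 < x i"
    "\<forall>i\<in>hg_verts G. edge_sum (hg_edges G) x i = c * x i ^ (k - 1)"
    using \<mu> unfolding H_plus_plus_adjacency_iff[OF G \<open>hg_verts G \<noteq> {}\<close>] by blast
  then have "H_plus_plus_eigenvalue (adjacency_tensor k C) \<mu>"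
    unfolding H_plus_plus_adjacency_iff[OF kC G(2) \<open>hg_verts C \<noteq> {}\<close>]
    using W'(2) edge_sum_class[OF G(1) W, of _ x]
    by (intro exI[of _ c] exI[of _ x]) (simp add: C subset_iff)
  then show ?thesis
    using H_plus_plus_adjacency_unique[OF kC G(2) \<open>hg_verts C \<noteq> {}\<close>] by blast
qed

section \<open>Components as a partition of the vertices\<close>

lemma component_containing:
  assumes "i \<in> hg_verts G"
  obtains C where "C \<in> hg_components G" "i \<in> hg_verts C"
proof -
  let ?W = "hg_connected_rel G `` {i}"
  let ?C = "\<lparr>hg_verts = ?W, hg_edges = {e \<in> hg_edges G. e \<subseteq> ?W}\<rparr>"
  have "?C \<in> hg_components G"
    unfolding hg_components_def by (intro imageI quotientI assms)
  moreover have "i \<in> hg_verts ?C"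
    using equiv_class_self[OF equiv_hg_connected_rel assms] by simp
  ultimately show ?thesis
    by (rule that)
qed

lemma component_verts_unique:
  assumes "C \<in> hg_components G" "D \<in> hg_components G" "i \<in> hg_verts C" "i \<in> hg_verts D"
  shows "C = D"
proof -
  have "hg_verts C = hg_verts D"
    using assms quotient_disj[OF equiv_hg_connected_rel, of "hg_verts C" G "hg_verts D"]
    by (auto simp: hg_components_def)
  then show ?thesis
    using assms(1,2) by (auto simp: hg_components_def)
qed

lemma component_edge_subset:
  assumes "k_graph k G" "C \<in> hg_components G" "e \<in> hg_edges G" "i \<in> e" "i \<in> hg_verts C"
  shows "e \<subseteq> hg_verts C"
  using assms(2-5) edge_subset_class[OF assms(1), of "hg_verts C" e i]
  by (auto simp: hg_components_def)

section \<open>Extending and gluing the eigenvectors of components\<close>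

lemma component_H_plus:
  assumes G: "k_graph k G" and k: "k \<ge> 2" and C: "C \<in> hg_components G"
  shows "H_plus_eigenvalue (adjacency_tensor k G)
    (complex_of_real (tensor_spectral_radius (adjacency_tensor k C)))"
proof -
  let ?\<rho> = "tensor_spectral_radius (adjacency_tensor k C)"
  have k0: "k > 0"
    using k by simp
  have C': "hg_verts C \<noteq> {}" "hg_verts C \<subseteq> hg_verts G"
    using C component_class[of _ G] by (force simp: hg_components_def)+
  obtain x where pos: "\<And>i. i \<in> hg_verts C \<Longrightarrow> 0 < x i"
    and x: "\<And>i. i \<in> hg_verts C \<Longrightarrow> edge_sum (hg_edges G) x i = ?\<rho> * x i ^ (k - 1)"
    using component_positive_eigenvector[OF G k0 C] by blast
  \<comment> \<open>Extension by zero: nonnegative, and nonzero exactly on \<open>C\<close>.\<close>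
  define y where "y i = (if i \<in> hg_verts C then x i else 0)" for i
  have "edge_sum (hg_edges G) y i = ?\<rho> * y i ^ (k - 1)" for i
  proof (cases "i \<in> hg_verts C")
    case True
    have "edge_sum (hg_edges G) y i = edge_sum (hg_edges G) x i"
      unfolding edge_sum_def y_def using component_edge_subset[OF G C _ _ True]
      by (intro sum.cong prod.cong) auto
    then show ?thesis
      using x True by (simp add: y_def)
  next
    case False
    \<comment> \<open>As \<open>k\<close> is at least 2, \<open>e\<close> has a second vertex
      \<open>j\<close>; it lies outside \<open>C\<close>, since otherwise all of \<open>e\<close>,
      including \<open>i\<close>, would lie in \<open>C\<close>.\<close>
    have "prod y (e - {i}) = 0" if e: "e \<in> {e \<in> hg_edges G. i \<in> e}" for e
    proof -
      have "card (e - {i}) = k - 1" "finite e"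
        using e G finite_subset by (auto simp: k_graph_def)
      then obtain j where "j \<in> e - {i}"
        using k by (metis One_nat_def all_not_in_conv card.empty diff_is_0_eq not_less_eq_eq numeral_2_eq_2)
      moreover have "y j = 0"
        using component_edge_subset[OF G C, of e j] e \<open>j \<in> e - {i}\<close> False by (auto simp: y_def)
      ultimately show ?thesis
        using \<open>finite e\<close> by (intro prod_zero) auto
    qed
    then show ?thesis
      using k False by (simp add: edge_sum_def y_def)
  qed
  moreover have "\<exists>i\<in>hg_verts G. y i \<noteq> 0"
    using C' pos by (force simp: y_def)
  moreover have "0 \<le> y i" for i
    using pos by (simp add: y_def less_imp_le)
  ultimately show ?thesis
    unfolding H_plus_eigenvalue_def H_eigenpair_def tensor_eigenpair_adjacency[OF G k0]
      edge_sum_of_real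
    by (intro exI[of _ y]) simp
qed

lemma H_plus_plus_glue:
  assumes G: "k_graph k G" "k > 0" and ne: "hg_verts G \<noteq> {}"
    and eq: "\<And>C. C \<in> hg_components G \<Longrightarrow> tensor_spectral_radius (adjacency_tensor k C) = c"
  shows "H_plus_plus_eigenvalue (adjacency_tensor k G) (complex_of_real c)"
proof -
  have "\<exists>x. (\<forall>i\<in>hg_verts C. 0 < x i) \<and>
      (\<forall>i\<in>hg_verts C. edge_sum (hg_edges G) x i = c * x i ^ (k - 1))"
    if "C \<in> hg_components G" for C
    using component_positive_eigenvector[OF G that] eq[OF that] by metis
  then obtain X where pos: "\<And>C i. C \<in> hg_components G \<Longrightarrow> i \<in> hg_verts C \<Longrightarrow> 0 < X C i"
    and X: "\<And>C i. C \<in> hg_components G \<Longrightarrow> i \<in> hg_verts C \<Longrightarrow>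
      edge_sum (hg_edges G) (X C) i = c * X C i ^ (k - 1)"
    by metis
  \<comment> \<open>The choice is unambiguous at each vertex, because distinct components are
    disjoint.\<close>
  define comp where "comp i = (SOME C. C \<in> hg_components G \<and> i \<in> hg_verts C)" for i
  have comp: "comp i = C" if C: "C \<in> hg_components G" "i \<in> hg_verts C" for C i
    unfolding comp_def
    by (rule some_equality) (auto intro: C component_verts_unique[OF _ C(1) _ C(2)])
  define x where "x i = X (comp i) i" for i
  have "0 < x i \<and> edge_sum (hg_edges G) x i = c * x i ^ (k - 1)" if i: "i \<in> hg_verts G" for i
  proof -
    obtain C where C: "C \<in> hg_components G" "i \<in> hg_verts C"
      using component_containing[OF i] .
    \<comment> \<open>All edges through \<open>i\<close> stay inside \<open>C\<close>, where
      \<open>x\<close> agrees with \<open>X C\<close>.\<close>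
    have "edge_sum (hg_edges G) x i = edge_sum (hg_edges G) (X C) i"
      unfolding edge_sum_def x_def using component_edge_subset[OF G(1) C(1) _ _ C(2)] comp[OF C(1)]
      by (intro sum.cong prod.cong) auto
    then show ?thesis
      using pos[OF C] X[OF C] comp[OF C] by (simp add: x_def)
  qed
  then show ?thesis
    unfolding H_plus_plus_adjacency_iff[OF G ne] by blast
qed

section \<open>Zero as a strict H+ eigenvalue\<close>

lemma zero_strict_H_plus:
  assumes G: "k_graph k G" and k: "k \<ge> 3" and e: "e \<in> hg_edges G"
  shows "strict_H_plus_eigenvalue (adjacency_tensor k G) 0"
proof -
  have k0: "k > 0"
    using k by simp
  have V: "finite (hg_verts G)" and E: "\<And>e. e \<in> hg_edges G \<Longrightarrow> e \<subseteq> hg_verts G \<and> card e = k"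
    using G by (auto simp: k_graph_def)
  have fE: "finite (hg_edges G)"
    using V E by (intro finite_edges_of_subset) auto
  have "e \<noteq> {}"
    using E[OF e] k by auto
  then obtain v where ve: "v \<in> e"
    by auto
  with E[OF e] have v: "v \<in> hg_verts G" and ne: "hg_verts G \<noteq> {}"
    by auto
  \<comment> \<open>The indicator of one vertex is an eigenvector for zero.\<close>
  define x :: "'a \<Rightarrow> real" where "x i = (if i = v then 1 else 0)" for i
  have "x v = 1" "\<And>i. 0 \<le> x i"
    by (simp_all add: x_def)
  have "edge_sum (hg_edges G) x i = 0" for i
    unfolding edge_sum_def
  proof (intro sum.neutral ballI)
    fix d assume d: "d \<in> {e \<in> hg_edges G. i \<in> e}"
    have fd: "finite d" "card d = k"
      using d E[of d] V finite_subset by auto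
    \<comment> \<open>Here \<open>k\<close> being at least 3 matters: a third vertex of
      \<open>d\<close> contributes a zero factor to the product over \<open>d - {i}\<close>.\<close>
    have "\<not> d \<subseteq> {i, v}"
    proof
      assume "d \<subseteq> {i, v}"
      then have "card d \<le> card {i, v}"
        by (intro card_mono) auto
      also have "\<dots> \<le> 2"
        by (simp add: card_insert_if)
      finally show False
        using fd k by simp
    qed
    then obtain j where "j \<in> d - {i}" "j \<noteq> v"
      by auto
    then show "prod x (d - {i}) = 0"
      using fd by (intro prod_zero) (auto simp: x_def)
  qed
  then have "H_plus_eigenvalue (adjacency_tensor k G) 0"
    unfolding H_plus_eigenvalue_def H_eigenpair_def tensor_eigenpair_adjacency[OF G k0]
      edge_sum_of_real
    using v \<open>x v = 1\<close> \<open>\<And>i. 0 \<le> x i\<close> by (intro exI[of _ x]) force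
  moreover have "\<not> H_plus_plus_eigenvalue (adjacency_tensor k G) 0"
  proof
    assume "H_plus_plus_eigenvalue (adjacency_tensor k G) 0"
    then obtain c y where "0 = complex_of_real c" and pos: "\<forall>i\<in>hg_verts G. 0 < y i"
      and y: "\<forall>i\<in>hg_verts G. edge_sum (hg_edges G) y i = c * y i ^ (k - 1)"
      using v unfolding H_plus_plus_adjacency_iff[OF G k0 ne] by blast
    then have "c = 0"
      by simp
    have "0 < edge_sum (hg_edges G) y v"
      by (rule edge_sum_positive[OF fE e ve]) (use pos E in blast)
    then show False
      using y v \<open>c = 0\<close> by simp
  qed
  ultimately show ?thesis
    by (simp add: strict_H_plus_eigenvalue_def)
qed

theorem theorem7:
  fixes k n s :: nat
    and G :: "nat hypergraph"
    and Gr :: "nat \<Rightarrow> nat hypergraph"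
    and lambda1 :: real
  assumes "k \<ge> 3"
    and "n \<ge> 1"
    and "hg_verts G = {1..n}"
    and "k_graph k G"
    and "\<forall>v\<in>hg_verts G. \<exists>e\<in>hg_edges G. v \<in> e"
    and "bij_betw Gr {1..s} (hg_components G)"
    and "lambda1 = tensor_spectral_radius (adjacency_tensor k G)"
  shows "strict_H_plus_eigenvalue (adjacency_tensor k G) 0 \<and>
    ((\<forall>r\<in>{1..s}. lambda1 = tensor_spectral_radius (adjacency_tensor k (Gr r))) \<longrightarrow>
       H_plus_plus_eigenvalue (adjacency_tensor k G) (complex_of_real lambda1) \<and>
       (\<forall>\<mu>. H_plus_plus_eigenvalue (adjacency_tensor k G) \<mu> \<longrightarrow> \<mu> = complex_of_real lambda1)) \<and>
    (\<not> (\<forall>r\<in>{1..s}. lambda1 = tensor_spectral_radius (adjacency_tensor k (Gr r))) \<longrightarrow>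
       (\<nexists>\<mu>. H_plus_plus_eigenvalue (adjacency_tensor k G) \<mu>) \<and>
       (\<forall>r\<in>{1..s}. strict_H_plus_eigenvalue (adjacency_tensor k G)
          (complex_of_real (tensor_spectral_radius (adjacency_tensor k (Gr r))))))"
proof -
  let ?A = "adjacency_tensor k G"
  have k: "k > 0" "k \<ge> 2" and ne: "hg_verts G \<noteq> {}"
    using assms(1-3) by auto
  have comps: "hg_components G = Gr ` {1..s}"
    using assms(6) by (simp add: bij_betw_def)
  obtain e where "e \<in> hg_edges G"
    using assms(5) ne by blast
  then have zero: "strict_H_plus_eigenvalue ?A 0"
    by (rule zero_strict_H_plus[OF assms(4,1)])
  have unique: "\<mu> = complex_of_real lambda1" if "H_plus_plus_eigenvalue ?A \<mu>" for \<mu>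
    using H_plus_plus_adjacency_unique[OF assms(4) k(1) ne that] assms(7) by simp
  have glue: "H_plus_plus_eigenvalue ?A (complex_of_real lambda1)"
    if "\<forall>r\<in>{1..s}. lambda1 = tensor_spectral_radius (adjacency_tensor k (Gr r))"
    by (rule H_plus_plus_glue[OF assms(4) k(1) ne]) (use that comps in auto)
  \<comment> \<open>An H++ eigenvalue equals both \<open>lambda1\<close> and the spectral radius of
    every component, so its existence would make them all agree.\<close>
  have none: "\<not> H_plus_plus_eigenvalue ?A \<mu>"
    if "\<not> (\<forall>r\<in>{1..s}. lambda1 = tensor_spectral_radius (adjacency_tensor k (Gr r)))" for \<mu>
  proof
    assume \<mu>: "H_plus_plus_eigenvalue ?A \<mu>"
    have "lambda1 = tensor_spectral_radius (adjacency_tensor k (Gr r))" if "r \<in> {1..s}" for r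
      using component_spectral_radius[OF assms(4) k(1) _ \<mu>, of "Gr r"] unique[OF \<mu>] comps that
      by simp
    with that show False
      by blast
  qed
  have plus: "H_plus_eigenvalue ?A
      (complex_of_real (tensor_spectral_radius (adjacency_tensor k (Gr r))))"
    if "r \<in> {1..s}" for r
    using component_H_plus[OF assms(4) k(2)] comps that by blast
  \<comment> \<open>In the second case strictness is immediate, since there is no H++ eigenvalue at
    all.\<close>
  show ?thesis
    using zero unique glue none plus unfolding strict_H_plus_eigenvalue_def by blast
qed

end
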